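(* Let $I=\langle\mathcal{A},\emptyset,\mathcal{R},\mathcal{R}^?\rangle$ be an AtIAF and $S\subseteq\mathcal{A}$ a set of arguments such that $S$ is not stable-$\mathtt{co}$ w.r.t. $I$. For each attack $r=(a,b)\in\mathcal{R}^?$ such that $a\notin S$ or $b\notin S$, the following holds. (1) If $a\notin S$ and $b\notin S$, then - $r\in RE^+(I,S,\mathtt{co}\text{-}true)$ iff $(b,b)\notin\mathcal{R}$ and $OutRel(I,S,r)=true$; and - $r\notin RE^-(I,S,\mathtt{co}\text{-}true)$. (2) If $a\notin S$ and $b\in S$, then - $r\notin RE^+(I,S,\mathtt{co}\text{-}true)$; and - $r\in RE^-(I,S,\mathtt{co}\text{-}true)$ iff $a\notin S_I^+$ and $PosVer_{\mathtt{co}}(I-\{(s,a)\in\mathcal{R}^?\mid s\in S\},S)=true$. (3) If $a\in S$ and $b\notin S$, then - $r\in RE^+(I,S,\mathtt{co}\text{-}true)$ iff either [$(b,b)\notin\mathcal{R}$ and $OutRel(I,S,r)=true$], or [$S\not\subseteq\{b\}^{\sim}_I$, $b\notin S^+_I$ and $PosVer_{\mathtt{co}}(I+\{(a,b)\},S)=true$]; and - $r\in RE^-(I,S,\mathtt{co}\text{-}true)$ iff there exists $v\in\mathcal{A}\setminus(S\cup\{b\})$ such that $(b,v)\in\mathcal{R}\cup\mathcal{R}^?$, $(v,v)\notin\mathcal{R}$ and $OutRel(I,S,(b,v))=true$.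
   Context: An argumentation framework (AF) is a pair $F=\langle \mathcal{A}_F,\mathcal{R}_F\rangle$ with $\mathcal{R}_F\subseteq\mathcal{A}_F\times\mathcal{A}_F$; $a$ attacks $b$ if $(a,b)\in\mathcal{R}_F$. For $S\subseteq\mathcal{A}_F$: $S$ attacks $a$ if some $b\in S$ attacks $a$; $S_F^+=\{a\in\mathcal{A}_F\mid S\text{ attacks }a\}$; $S$ is conflict-free iff $S\cap S_F^+=\emptyset$; $S$ defends $a$ if every attacker of $a$ is attacked by $S$; $\Gamma_F(S)$ is the set of arguments of $F$ defended by $S$. $S$ is admissible, $S\in\mathtt{ad}(F)$, iff $S\subseteq\mathcal{A}_F$ is conflict-free and $S\subseteq\Gamma_F(S)$. $S$ is complete, $S\in\mathtt{co}(F)$, iff $S\in\mathtt{ad}(F)$ and $\Gamma_F(S)\subseteq S$. $S$ is $\mathtt{co}$-$true$ in $F$ iff $S\in\mathtt{co}(F)$ and $\mathtt{co}$-$false$ otherwise. An incomplete argumentation framework (IAF) is $I=\langle\mathcal{A},\mathcal{A}^?,\mathcal{R},\mathcal{R}^?\rangle$ with $\mathcal{A},\mathcal{A}^?$ disjoint sets of (certain, uncertain) arguments and $\mathcal{R},\mathcal{R}^?$ disjoint subsets of $(\mathcal{A}\cup\mathcal{A}^?)\times(\mathcal{A}\cup\mathcal{A}^?)$ (certain, uncertain attacks). An AtIAF is an IAF with $\mathcal{A}^?=\emptyset$. A partial completion of $I$ is an IAF $I'=\langle\mathcal{A}',\mathcal{A}^{?'},\mathcal{R}',\mathcal{R}^{?'}\rangle$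 with $\mathcal{A}\subseteq\mathcal{A}'\subseteq\mathcal{A}\cup\mathcal{A}^?$, $\mathcal{R}\cap((\mathcal{A}'\cup\mathcal{A}^{?'})\times(\mathcal{A}'\cup\mathcal{A}^{?'}))\subseteq\mathcal{R}'\subseteq\mathcal{R}\cup\mathcal{R}^?$, $\mathcal{A}^{?'}\subseteq\mathcal{A}^?$, $\mathcal{R}^{?'}\subseteq\mathcal{R}^?$; $part(I)$ is the set of partial completions. $cert(I)=\langle\mathcal{A},\mathcal{R}\cap(\mathcal{A}\times\mathcal{A})\rangle$. A completion of $I$ is an AF of the form $cert(I')$ with $I'\in part(I)$ (for an AtIAF: an AF $\langle\mathcal{A},\mathcal{R}_F\rangle$ with $\mathcal{R}\subseteq\mathcal{R}_F\subseteq\mathcal{R}\cup\mathcal{R}^?$). For a set $\mathcal{R}_0\subseteq\mathcal{R}^?$: $I+\mathcal{R}_0=\langle\mathcal{A},\mathcal{A}^?,\mathcal{R}\cup\mathcal{R}_0,\mathcal{R}^?\setminus\mathcal{R}_0\rangle$ and $I-\mathcal{R}_0=\langle\mathcal{A},\mathcal{A}^?,\mathcal{R},\mathcal{R}^?\setminus\mathcal{R}_0\rangle$. For $S\subseteq\mathcal{A}\cup\mathcal{A}^?$: $S_I^+=\{a\in\mathcal{A}\cup\mathcal{A}^?\mid\exists b\in S,(b,a)\in\mathcal{R}\}$, $S_I^-=\{a\in\mathcal{A}\cup\mathcal{A}^?\mid\exists b\in S,(a,b)\in\mathcal{R}\}$, $S_I^{\sim}=\{a\in\mathcal{A}\cup\mathcal{A}^?\mid\forall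 b\in S,(b,a)\notin\mathcal{R}\cup\mathcal{R}^?\}$. $S$ is stable-$\mathtt{co}$ w.r.t. $I$ iff either $S\in\mathtt{co}(F)$ for every completion $F$ of $I$, or $S\notin\mathtt{co}(F)$ for every completion $F$ of $I$. $PosVer_{\mathtt{co}}(I,S)=true$ iff there is a completion $F$ of $I$ with $S\in\mathtt{co}(F)$. Relevance: for an uncertain attack $e\in\mathcal{R}^?$, $e\in RE^+(I,S,\mathtt{co}\text{-}true)$ (resp. $e\in RE^-(I,S,\mathtt{co}\text{-}true)$) iff there is $I'=\langle\mathcal{A}',\mathcal{A}^{?'},\mathcal{R}',\mathcal{R}^{?'}\rangle\in part(I)$ with $\mathcal{A}^{?'}\cup\mathcal{R}^{?'}=\{e\}$ such that $S$ is $\mathtt{co}$-$true$ in $cert(I'+\{e\})$ (resp. $cert(I'-\{e\})$) and $S$ is not $\mathtt{co}$-$true$ in $cert(I'-\{e\})$ (resp. $cert(I'+\{e\})$). Algorithm $OutRel(I,S,(a,b))$, with input an AtIAF $I=\langle\mathcal{A},\emptyset,\mathcal{R},\mathcal{R}^?\rangle$, $S\subseteq\mathcal{A}$, and an attack $(a,b)\in\mathcal{R}\cup\mathcal{R}^?$ with $b\notin S$ and $(b,b)\notin\mathcal{R}$: (i) if $(\{b\}_I^-\setminus\{a\})\cap S_I^{\sim}\neq\emptyset$, return $false$; (ii) otherwise let $I_0=I+\{(s,v)\in\mathcal{R}^?\mid s\in S,\ v\in\{b\}_I^-\setminus\{a\}\}$; (iii) let $I_1=I_0-\{(u,b)\mid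 (u,b)\text{ an uncertain attack},\ u\neq a\}$; (iv) return $PosVer_{\mathtt{co}}(I_1,S)$. *)

theory Defs
  imports Main
begin

record 'a af =
  af_args :: "'a set"
  af_atts :: "('a \<times> 'a) set"

definition is_af :: "'a af \<Rightarrow> bool" where
  "is_af F \<longleftrightarrow> af_atts F \<subseteq> af_args F \<times> af_args F"

definition attacked :: "'a af \<Rightarrow> 'a set \<Rightarrow> 'a set" where
  "attacked F S = {a \<in> af_args F. \<exists>b\<in>S. (b, a) \<in> af_atts F}"

definition conflict_free :: "'a af \<Rightarrow> 'a set \<Rightarrow> bool" where
  "conflict_free F S \<longleftrightarrow> S \<inter> attacked F S = {}"

definition defends :: "'a af \<Rightarrow> 'a set \<Rightarrow> 'a \<Rightarrow> bool" where
  "defends F S a \<longleftrightarrow> (\<forall>b. (b, a) \<in> af_atts F \<longrightarrow> b \<in> attacked F S)"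

definition defended :: "'a af \<Rightarrow> 'a set \<Rightarrow> 'a set" where
  "defended F S = {a \<in> af_args F. defends F S a}"

definition ad :: "'a af \<Rightarrow> 'a set set" where
  "ad F = {S. S \<subseteq> af_args F \<and> conflict_free F S \<and> S \<subseteq> defended F S}"

definition co :: "'a af \<Rightarrow> 'a set set" where
  "co F = {S. S \<in> ad F \<and> defended F S \<subseteq> S}"

definition co_true :: "'a af \<Rightarrow> 'a set \<Rightarrow> bool" where
  "co_true F S \<longleftrightarrow> S \<in> co F"

record 'a iaf =
  args :: "'a set"
  uargs :: "'a set"
  atts :: "('a \<times> 'a) set"
  uatts :: "('a \<times> 'a) set"

definition is_iaf :: "'a iaf \<Rightarrow> bool" where
  "is_iaf I \<longleftrightarrow>
     args I \<inter> uargs I = {} \<and> atts I \<inter> uatts I = {} \<and>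
     atts I \<subseteq> (args I \<union> uargs I) \<times> (args I \<union> uargs I) \<and>
     uatts I \<subseteq> (args I \<union> uargs I) \<times> (args I \<union> uargs I)"

definition is_atiaf :: "'a iaf \<Rightarrow> bool" where
  "is_atiaf I \<longleftrightarrow> is_iaf I \<and> uargs I = {}"

definition part :: "'a iaf \<Rightarrow> 'a iaf set" where
  "part I = {I'. is_iaf I' \<and>
     args I \<subseteq> args I' \<and> args I' \<subseteq> args I \<union> uargs I \<and>
     atts I \<inter> ((args I' \<union> uargs I') \<times> (args I' \<union> uargs I')) \<subseteq> atts I' \<and>
     atts I' \<subseteq> atts I \<union> uatts I \<and>
     uargs I' \<subseteq> uargs I \<and> uatts I' \<subseteq> uatts I}"

definition cert :: "'a iaf \<Rightarrow> 'a af" where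
  "cert I = \<lparr>af_args = args I, af_atts = atts I \<inter> (args I \<times> args I)\<rparr>"

definition completions :: "'a iaf \<Rightarrow> 'a af set" where
  "completions I = cert ` part I"

definition add_atts :: "'a iaf \<Rightarrow> ('a \<times> 'a) set \<Rightarrow> 'a iaf" where
  "add_atts I R0 = I\<lparr>atts := atts I \<union> R0, uatts := uatts I - R0\<rparr>"

definition del_atts :: "'a iaf \<Rightarrow> ('a \<times> 'a) set \<Rightarrow> 'a iaf" where
  "del_atts I R0 = I\<lparr>uatts := uatts I - R0\<rparr>"

text \<open>The sets $S_I^+$, $S_I^-$ and $S_I^{\sim}$. The first two refer to certain attacks only,
  the last one to certain and uncertain attacks.\<close>

definition out_set :: "'a iaf \<Rightarrow> 'a set \<Rightarrow> 'a set" where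
  "out_set I S = {a \<in> args I \<union> uargs I. \<exists>b\<in>S. (b, a) \<in> atts I}"

definition in_set :: "'a iaf \<Rightarrow> 'a set \<Rightarrow> 'a set" where
  "in_set I S = {a \<in> args I \<union> uargs I. \<exists>b\<in>S. (a, b) \<in> atts I}"

definition non_out_set :: "'a iaf \<Rightarrow> 'a set \<Rightarrow> 'a set" where
  "non_out_set I S = {a \<in> args I \<union> uargs I. \<forall>b\<in>S. (b, a) \<notin> atts I \<union> uatts I}"

definition stable_co :: "'a iaf \<Rightarrow> 'a set \<Rightarrow> bool" where
  "stable_co I S \<longleftrightarrow>
     (\<forall>F \<in> completions I. S \<in> co F) \<or> (\<forall>F \<in> completions I. S \<notin> co F)"

definition PosVer_co :: "'a iaf \<Rightarrow> 'a set \<Rightarrow> bool" where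
  "PosVer_co I S \<longleftrightarrow> (\<exists>F \<in> completions I. S \<in> co F)"

text \<open>The parameter \<open>st\<close> is the status, e.g. \<^const>\<open>co_true\<close>. Arguments and attacks have
  different types, so the condition that $e$ is the only uncertain element of $I'$, i.e.
  $\mathcal{A}^{?'} \cup \mathcal{R}^{?'} = \{e\}$ for an attack $e$, is stated componentwise.\<close>

definition RE_plus :: "'a iaf \<Rightarrow> 'a set \<Rightarrow> ('a af \<Rightarrow> 'a set \<Rightarrow> bool) \<Rightarrow> ('a \<times> 'a) set" where
  "RE_plus I S st = {e \<in> uatts I. \<exists>I' \<in> part I. uargs I' = {} \<and> uatts I' = {e} \<and>
     st (cert (add_atts I' {e})) S \<and> \<not> st (cert (del_atts I' {e})) S}"

definition RE_minus :: "'a iaf \<Rightarrow> 'a set \<Rightarrow> ('a af \<Rightarrow> 'a set \<Rightarrow> bool) \<Rightarrow> ('a \<times> 'a) set" where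
  "RE_minus I S st = {e \<in> uatts I. \<exists>I' \<in> part I. uargs I' = {} \<and> uatts I' = {e} \<and>
     st (cert (del_atts I' {e})) S \<and> \<not> st (cert (add_atts I' {e})) S}"

text \<open>Only meaningful for an AtIAF $I$ with $S \subseteq \mathcal{A}$,
  $(a,b) \in \mathcal{R} \cup \mathcal{R}^?$, $b \notin S$ and $(b,b) \notin \mathcal{R}$.\<close>

definition OutRel :: "'a iaf \<Rightarrow> 'a set \<Rightarrow> 'a \<times> 'a \<Rightarrow> bool" where
  "OutRel I S = (\<lambda>(a, b).
     if (in_set I {b} - {a}) \<inter> non_out_set I S \<noteq> {} then False
     else
       let I0 = add_atts I {(s, v) \<in> uatts I. s \<in> S \<and> v \<in> in_set I {b} - {a}};
           I1 = del_atts I0 {(u, w) \<in> uatts I0. w = b \<and> u \<noteq> a}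
       in PosVer_co I1 S)"

lemma is_af_completion: "F \<in> completions I \<Longrightarrow> is_af F"
  by (auto simp: completions_def cert_def is_af_def)

lemma completions_atiaf:
  assumes "is_atiaf I"
  shows "completions I =
    {\<lparr>af_args = args I, af_atts = R\<rparr> | R. atts I \<subseteq> R \<and> R \<subseteq> atts I \<union> uatts I}"
proof (intro equalityI subsetI)
  fix F assume "F \<in> completions I"
  then obtain I' where "I' \<in> part I" "F = cert I'"
    by (auto simp: completions_def)
  moreover from this have "args I' = args I" "uargs I' = {}"
    using assms by (auto simp: part_def is_atiaf_def)
  ultimately show
    "F \<in> {\<lparr>af_args = args I, af_atts = R\<rparr> | R. atts I \<subseteq> R \<and> R \<subseteq> atts I \<union> uatts I}"
    using assms by (auto simp: part_def is_atiaf_def is_iaf_def cert_def)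
next
  fix F assume "F \<in> {\<lparr>af_args = args I, af_atts = R\<rparr> | R. atts I \<subseteq> R \<and> R \<subseteq> atts I \<union> uatts I}"
  then obtain R where R: "F = \<lparr>af_args = args I, af_atts = R\<rparr>"
      "atts I \<subseteq> R" "R \<subseteq> atts I \<union> uatts I"
    by blast
  let ?I' = "\<lparr>args = args I, uargs = {}, atts = R, uatts = {}\<rparr>"
  have "R \<subseteq> args I \<times> args I"
    using R(2,3) assms unfolding is_atiaf_def is_iaf_def by blast
  then have "?I' \<in> part I" "F = cert ?I'"
    using R by (auto simp: part_def is_iaf_def cert_def)
  then show "F \<in> completions I"
    by (auto simp: completions_def)
qed

end

theory Submission
  imports Defs
begin

text \<open>For \<open>a \<notin> S\<close>, switching an attack \<open>(a, b)\<close> on or off leaves the set attacked by \<open>S\<close> unchanged,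
  and for \<open>a \<in> S\<close> it changes at most the membership of \<open>b\<close>. Hence the status of \<open>S\<close> can only change
  because an argument that \<open>S\<close> does not attack attacks \<open>S\<close>, or because some \<open>v \<notin> S\<close> has exactly one attacker that \<open>S\<close> does not attack.
  \<open>OutRel I S (u, v)\<close> says that some completion in which \<open>S\<close> is complete has \<open>u\<close> as this only
  attacker of \<open>v\<close>: adding attacks from \<open>S\<close> to the other certain attackers of \<open>v\<close> and
  removing the other uncertain attacks on \<open>v\<close> affects neither the set attacked by \<open>S\<close> nor the
  completeness of \<open>S\<close>.\<close>

section \<open>Complete sets in terms of the attack relation\<close>

text \<open>The arguments \<open>A\<close> are held fixed and only \<open>R\<close> varies, since in
  an AtIAF all uncertainty lies in the attacks. The image of \<open>S\<close> under \<open>R\<close>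
  is the attacked set, and the last conjunct is the contrapositive of the closure condition: no
  argument outside \<open>S\<close> is defended.\<close>

definition complete_in :: "'a set \<Rightarrow> 'a set \<Rightarrow> ('a \<times> 'a) set \<Rightarrow> bool" where
  "complete_in A S R \<longleftrightarrow>
     S \<inter> R `` S = {} \<and>
     (\<forall>x\<in>S. \<forall>y. (y, x) \<in> R \<longrightarrow> y \<in> R `` S) \<and>
     (\<forall>x\<in>A - S. \<exists>y. (y, x) \<in> R \<and> y \<notin> R `` S)"

lemma co_iff_complete_in:
  assumes "R \<subseteq> A \<times> A" "S \<subseteq> A"
  shows "S \<in> co \<lparr>af_args = A, af_atts = R\<rparr> \<longleftrightarrow> complete_in A S R"
proof -
  have "attacked \<lparr>af_args = A, af_atts = R\<rparr> S = R `` S"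
    using assms by (auto simp: attacked_def)
  then show ?thesis
    using assms(2)
    by (auto simp: co_def ad_def conflict_free_def defended_def defends_def complete_in_def)
qed

lemma atiaf_atts:
  assumes "is_atiaf I"
  shows "atts I \<subseteq> args I \<times> args I" "uatts I \<subseteq> args I \<times> args I" "atts I \<inter> uatts I = {}"
  using assms by (auto simp: is_atiaf_def is_iaf_def)

lemma PosVer_co_iff:
  assumes "is_atiaf I" "S \<subseteq> args I"
  shows "PosVer_co I S \<longleftrightarrow>
    (\<exists>R. atts I \<subseteq> R \<and> R \<subseteq> atts I \<union> uatts I \<and> complete_in (args I) S R)"
proof -
  have "S \<in> co \<lparr>af_args = args I, af_atts = R\<rparr> \<longleftrightarrow> complete_in (args I) S R"
    if "R \<subseteq> atts I \<union> uatts I" for R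
    using that atiaf_atts[OF assms(1)] by (intro co_iff_complete_in assms(2)) blast
  then show ?thesis
    unfolding PosVer_co_def completions_atiaf[OF assms(1)] by blast
qed

lemma is_atiaf_add_atts: "is_atiaf I \<Longrightarrow> R \<subseteq> uatts I \<Longrightarrow> is_atiaf (add_atts I R)"
  by (auto simp: is_atiaf_def is_iaf_def add_atts_def)

lemma is_atiaf_del_atts: "is_atiaf I \<Longrightarrow> is_atiaf (del_atts I R)"
  by (auto simp: is_atiaf_def is_iaf_def del_atts_def)

section \<open>Relevance as switching one attack in a completion\<close>

text \<open>Without uncertain arguments \<open>I'\<close> has the arguments of \<open>I\<close>, and
  \<open>e\<close> is missing from \<open>atts I'\<close> because certain and uncertain attacks are
  disjoint; so only a relation \<open>R\<close> remains to be chosen. Keeping \<open>P\<close>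
  abstract serves both notions of relevance.\<close>

lemma ex_part_single_iff:
  assumes "is_atiaf I" "e \<in> uatts I"
  shows "(\<exists>I'\<in>part I. uargs I' = {} \<and> uatts I' = {e} \<and> P (args I') (atts I')) \<longleftrightarrow>
    (\<exists>R. atts I \<subseteq> R \<and> R \<subseteq> atts I \<union> uatts I - {e} \<and> P (args I) R)"
proof
  assume "\<exists>I'\<in>part I. uargs I' = {} \<and> uatts I' = {e} \<and> P (args I') (atts I')"
  then obtain I' where I': "I' \<in> part I" "uargs I' = {}" "uatts I' = {e}" "P (args I') (atts I')"
    by blast
  have args: "args I' = args I"
    using I'(1) assms(1) by (auto simp: part_def is_atiaf_def)
  have "atts I \<subseteq> atts I'"
    using I'(1) atiaf_atts(1)[OF assms(1)] args by (auto simp: part_def)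
  moreover have "atts I' \<subseteq> atts I \<union> uatts I - {e}"
    using I'(1,3) by (auto simp: part_def is_iaf_def)
  ultimately show "\<exists>R. atts I \<subseteq> R \<and> R \<subseteq> atts I \<union> uatts I - {e} \<and> P (args I) R"
    using I'(4) args by auto
next
  assume "\<exists>R. atts I \<subseteq> R \<and> R \<subseteq> atts I \<union> uatts I - {e} \<and> P (args I) R"
  then obtain R where R: "atts I \<subseteq> R" "R \<subseteq> atts I \<union> uatts I - {e}" "P (args I) R"
    by blast
  let ?I' = "\<lparr>args = args I, uargs = {}, atts = R, uatts = {e}\<rparr>"
  have "R \<subseteq> args I \<times> args I" "e \<in> args I \<times> args I"
    using R(2) atiaf_atts[OF assms(1)] assms(2) by blast+
  then have "?I' \<in> part I"
    using R(1,2) assms(2) by (auto simp: part_def is_iaf_def)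
  with R(3) show "\<exists>I'\<in>part I. uargs I' = {} \<and> uatts I' = {e} \<and> P (args I') (atts I')"
    by (intro bexI[of _ ?I']) auto
qed

lemma co_true_cert:
  assumes "is_atiaf I" "S \<subseteq> args I" "R \<subseteq> atts I \<union> uatts I"
  shows "co_true \<lparr>af_args = args I, af_atts = R \<inter> (args I \<times> args I)\<rparr> S \<longleftrightarrow>
    complete_in (args I) S R"
proof -
  have "R \<subseteq> args I \<times> args I"
    using assms(3) atiaf_atts[OF assms(1)] by blast
  then show ?thesis
    using co_iff_complete_in[OF _ assms(2)] by (simp add: co_true_def Int_absorb2)
qed

lemma RE_plus_iff:
  assumes "is_atiaf I" "S \<subseteq> args I" "e \<in> uatts I"
  shows "e \<in> RE_plus I S co_true \<longleftrightarrow>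
    (\<exists>R. atts I \<subseteq> R \<and> R \<subseteq> atts I \<union> uatts I - {e} \<and>
      complete_in (args I) S (insert e R) \<and> \<not> complete_in (args I) S R)"
proof -
  let ?F = "\<lambda>A R. \<lparr>af_args = A, af_atts = R \<inter> (A \<times> A)\<rparr>"
  have "e \<in> RE_plus I S co_true \<longleftrightarrow>
    (\<exists>R. atts I \<subseteq> R \<and> R \<subseteq> atts I \<union> uatts I - {e} \<and>
      co_true (?F (args I) (R \<union> {e})) S \<and> \<not> co_true (?F (args I) R) S)"
    using assms(3)
      ex_part_single_iff[OF assms(1,3), of "\<lambda>A R. co_true (?F A (R \<union> {e})) S \<and> \<not> co_true (?F A R) S"]
    by (simp add: RE_plus_def cert_def add_atts_def del_atts_def)
  moreover have "co_true (?F (args I) (R \<union> {e})) S \<longleftrightarrow> complete_in (args I) S (insert e R)"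
    "co_true (?F (args I) R) S \<longleftrightarrow> complete_in (args I) S R"
    if "R \<subseteq> atts I \<union> uatts I - {e}" for R
    using that assms(3) co_true_cert[OF assms(1,2), of "R \<union> {e}"] co_true_cert[OF assms(1,2), of R]
    by auto
  ultimately show ?thesis
    by blast
qed

lemma RE_minus_iff:
  assumes "is_atiaf I" "S \<subseteq> args I" "e \<in> uatts I"
  shows "e \<in> RE_minus I S co_true \<longleftrightarrow>
    (\<exists>R. atts I \<subseteq> R \<and> R \<subseteq> atts I \<union> uatts I - {e} \<and>
      complete_in (args I) S R \<and> \<not> complete_in (args I) S (insert e R))"
proof -
  let ?F = "\<lambda>A R. \<lparr>af_args = A, af_atts = R \<inter> (A \<times> A)\<rparr>"
  have "e \<in> RE_minus I S co_true \<longleftrightarrow>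
    (\<exists>R. atts I \<subseteq> R \<and> R \<subseteq> atts I \<union> uatts I - {e} \<and>
      co_true (?F (args I) R) S \<and> \<not> co_true (?F (args I) (R \<union> {e})) S)"
    using assms(3)
      ex_part_single_iff[OF assms(1,3), of "\<lambda>A R. co_true (?F A R) S \<and> \<not> co_true (?F A (R \<union> {e})) S"]
    by (simp add: RE_minus_def cert_def add_atts_def del_atts_def)
  moreover have "co_true (?F (args I) (R \<union> {e})) S \<longleftrightarrow> complete_in (args I) S (insert e R)"
    "co_true (?F (args I) R) S \<longleftrightarrow> complete_in (args I) S R"
    if "R \<subseteq> atts I \<union> uatts I - {e}" for R
    using that assms(3) co_true_cert[OF assms(1,2), of "R \<union> {e}"] co_true_cert[OF assms(1,2), of R]
    by auto
  ultimately show ?thesis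
    by blast
qed

section \<open>What \<open>OutRel\<close> decides\<close>

text \<open>Removing \<open>(a, b)\<close> matters when \<open>a \<in> S\<close> and \<open>b\<close> attacks itself: that attack must not be
  considered answered by \<open>(a, b)\<close>.\<close>

definition sole_attacker :: "'a set \<Rightarrow> ('a \<times> 'a) set \<Rightarrow> 'a \<Rightarrow> 'a \<Rightarrow> bool" where
  "sole_attacker S R a b \<longleftrightarrow>
     (a, b) \<in> R \<and> a \<notin> R `` S \<and> (\<forall>u. (u, b) \<in> R \<and> u \<noteq> a \<longrightarrow> u \<in> (R - {(a, b)}) `` S)"

text \<open>From left to right, \<open>S\<close> attacks every attacker of \<open>b\<close> other
  than \<open>a\<close> in each completion of \<open>J\<close>, and \<open>b\<close> is not
  defended, so \<open>a\<close> is the one left unanswered. From right to left, the changes leading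
  from \<open>I\<close> to \<open>J\<close> are applied to \<open>R\<close> itself.\<close>

lemma OutRel_iff:
  assumes I: "is_atiaf I" and S: "S \<subseteq> args I"
    and ab: "(a, b) \<in> atts I \<union> uatts I" and b: "b \<notin> S" "(b, b) \<notin> atts I"
  shows "OutRel I S (a, b) \<longleftrightarrow>
    (\<exists>R. atts I \<subseteq> R \<and> R \<subseteq> atts I \<union> uatts I \<and> complete_in (args I) S R \<and> sole_attacker S R a b)"
proof -
  define X where "X = {(s, v) \<in> uatts I. s \<in> S \<and> v \<in> in_set I {b} - {a}}"
  define Y where "Y = {(u, w) \<in> uatts (add_atts I X). w = b \<and> u \<noteq> a}"
  define J where "J = del_atts (add_atts I X) Y"
  have J: "is_atiaf J" "args J = args I" "atts J = atts I \<union> X" "uatts J = uatts I - X - Y"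
    using is_atiaf_del_atts[OF is_atiaf_add_atts[OF I, of X]]
    by (auto simp: J_def add_atts_def del_atts_def X_def)
  have bA: "b \<in> args I"
    using ab atiaf_atts[OF I] by blast
  have in_b: "u \<in> in_set I {b} \<longleftrightarrow> (u, b) \<in> atts I" for u
    using atiaf_atts(1)[OF I] by (auto simp: in_set_def)
  have non_out: "u \<in> non_out_set I S \<longleftrightarrow> u \<in> args I \<and> (\<forall>s\<in>S. (s, u) \<notin> atts I \<union> uatts I)" for u
    using I by (auto simp: non_out_set_def is_atiaf_def)
  have Y: "(u, w) \<in> Y \<longleftrightarrow> (u, w) \<in> uatts I - X \<and> w = b \<and> u \<noteq> a" for u w
    by (auto simp: Y_def add_atts_def)
  have OutRel: "OutRel I S (a, b) \<longleftrightarrow>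
    (in_set I {b} - {a}) \<inter> non_out_set I S = {} \<and> PosVer_co J S"
    unfolding OutRel_def prod.case Let_def X_def[symmetric] Y_def[symmetric] J_def[symmetric] by simp
  show ?thesis
  proof
    assume "OutRel I S (a, b)"
    then have dis: "(in_set I {b} - {a}) \<inter> non_out_set I S = {}" and "PosVer_co J S"
      unfolding OutRel by auto
    then obtain R where R: "atts J \<subseteq> R" "R \<subseteq> atts J \<union> uatts J" "complete_in (args I) S R"
      using PosVer_co_iff[OF J(1)] S J(2) by auto
    \<comment> \<open>With \<open>Y\<close> removed, \<open>u\<close> must be a certain attacker of
      \<open>b\<close>. The test on \<open>non_out_set\<close> yields a possible attack on
      \<open>u\<close> from \<open>S\<close>, which is certain in \<open>J\<close> by the choice of
      \<open>X\<close>. It differs from \<open>(a, b)\<close> because \<open>b\<close> does not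
      certainly attack itself.\<close>
    have att: "u \<in> (R - {(a, b)}) `` S" if "(u, b) \<in> R" "u \<noteq> a" for u
    proof -
      have u: "(u, b) \<in> atts I"
        using that R(2) J(3,4) b(2) Y[of u b] in_b by (auto simp: X_def)
      then have "u \<notin> non_out_set I S" "u \<in> args I"
        using dis that(2) in_b atiaf_atts(1)[OF I] by auto
      then obtain s where "s \<in> S" "(s, u) \<in> atts I \<union> uatts I"
        using non_out by auto
      moreover from this have "(s, u) \<in> atts J"
        using u that(2) in_b J(3) by (auto simp: X_def)
      moreover have "u \<noteq> b"
        using u b(2) by blast
      ultimately show ?thesis
        using R(1) by auto
    qed
    obtain y where y: "(y, b) \<in> R" "y \<notin> R `` S"
      using R(3) bA b(1) unfolding complete_in_def by blast
    have "sole_attacker S R a b"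
      using att y unfolding sole_attacker_def by blast
    moreover have "atts I \<subseteq> R" "R \<subseteq> atts I \<union> uatts I"
      using R(1,2) J(3,4) by (auto simp: X_def)
    ultimately show "\<exists>R. atts I \<subseteq> R \<and> R \<subseteq> atts I \<union> uatts I \<and> complete_in (args I) S R \<and>
        sole_attacker S R a b"
      using R(3) by blast
  next
    assume "\<exists>R. atts I \<subseteq> R \<and> R \<subseteq> atts I \<union> uatts I \<and> complete_in (args I) S R \<and>
        sole_attacker S R a b"
    then obtain R where R: "atts I \<subseteq> R" "R \<subseteq> atts I \<union> uatts I" "complete_in (args I) S R"
        "sole_attacker S R a b"
      by blast
    have S_free: "s \<notin> R `` S" if "s \<in> S" for s
      using R(3) that unfolding complete_in_def by blast
    have sole: "(a, b) \<in> R" "a \<notin> R `` S" "\<And>u. (u, b) \<in> R \<Longrightarrow> u \<noteq> a \<Longrightarrow> u \<in> R `` S"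
      using R(4) unfolding sole_attacker_def by auto
    have "(in_set I {b} - {a}) \<inter> non_out_set I S = {}"
    proof -
      have "u \<notin> non_out_set I S" if u: "(u, b) \<in> atts I" "u \<noteq> a" for u
      proof -
        have "u \<in> R `` S"
          using sole(3) R(1) u by blast
        then show ?thesis
          using R(2) by (auto simp: non_out)
      qed
      then show ?thesis
        using in_b by auto
    qed
    moreover have "PosVer_co J S"
    proof -
      define R' where "R' = R \<union> X - Y"
      have Y_D: "w = b \<and> u \<noteq> a" if "(u, w) \<in> Y" for u w
        using that Y by auto
      have XY: "X \<inter> Y = {}"
        using Y by auto
      \<comment> \<open>The targets of \<open>X\<close> are certain attackers of \<open>b\<close>
        other than \<open>a\<close>, and \<open>S\<close> attacks these in \<open>R\<close> already.
        Hence \<open>X\<close> adds nothing to the attacked set.\<close>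
      have X_target: "w \<in> R `` S" if "(s, w) \<in> X" for s w
        using that sole(3)[of w] R(1) in_b unfolding X_def by auto
      have im: "R' `` S = R `` S"
      proof (intro equalityI subsetI)
        fix w assume "w \<in> R' `` S"
        then show "w \<in> R `` S"
          using X_target unfolding R'_def by blast
      next
        fix w assume "w \<in> R `` S"
        then obtain s where s: "s \<in> S" "(s, w) \<in> R"
          by blast
        \<comment> \<open>An attack of \<open>R\<close> removed with \<open>Y\<close> cannot start
          in \<open>S\<close>: its source would be an attacker of \<open>b\<close> other than
          \<open>a\<close>, hence attacked by \<open>S\<close>.\<close>
        have "(s, w) \<notin> Y"
        proof
          assume "(s, w) \<in> Y"
          then have "s \<in> R `` S"
            using Y_D s(2) sole(3) by blast
          then show False
            using S_free s(1) by blast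
        qed
        then show "w \<in> R' `` S"
          using s unfolding R'_def by blast
      qed
      have "atts J \<subseteq> R'"
        using R(1) XY J(3) Y atiaf_atts(3)[OF I] unfolding R'_def by auto
      moreover have "R' \<subseteq> atts J \<union> uatts J"
        using R(2) J(3,4) unfolding R'_def by auto
      moreover have "complete_in (args I) S R'"
        unfolding complete_in_def im
      proof (intro conjI ballI allI impI)
        show "S \<inter> R `` S = {}"
          using S_free by blast
      next
        fix x y assume "x \<in> S" "(y, x) \<in> R'"
        then show "y \<in> R `` S"
          using R(3) X_target S_free unfolding complete_in_def R'_def by blast
      next
        fix x assume x: "x \<in> args I - S"
        \<comment> \<open>Only attacks on \<open>b\<close> are removed, and there \<open>a\<close>
          remains as an unanswered attacker.\<close>
        show "\<exists>y. (y, x) \<in> R' \<and> y \<notin> R `` S"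
        proof (cases "x = b")
          case True
          then show ?thesis
            using sole(1,2) Y_D unfolding R'_def by blast
        next
          case False
          then show ?thesis
            using R(3) x False Y_D unfolding complete_in_def R'_def by blast
        qed
      qed
      ultimately show ?thesis
        using PosVer_co_iff[OF J(1)] S J(2) by auto
    qed
    ultimately show "OutRel I S (a, b)"
      unfolding OutRel by blast
  qed
qed

text \<open>A self-attack of \<open>b\<close> would be answered by some \<open>s \<in> S\<close>
  with \<open>s \<noteq> a\<close> attacking \<open>b\<close>. Being another attacker of
  \<open>b\<close>, this \<open>s\<close> would itself be attacked by \<open>S\<close>. The lemma
  supplies the condition on \<open>(b, b)\<close> under which \<open>OutRel_iff\<close>
  applies.\<close>

lemma sole_attacker_not_self:
  assumes "complete_in A S R" "sole_attacker S R a b" "a \<noteq> b"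
  shows "(b, b) \<notin> R"
proof
  assume "(b, b) \<in> R"
  then obtain s where "s \<in> S" "(s, b) \<in> R" "s \<noteq> a"
    using assms(2,3) unfolding sole_attacker_def by blast
  then have "s \<in> R `` S"
    using assms(2) unfolding sole_attacker_def by blast
  with \<open>s \<in> S\<close> show False
    using assms(1) unfolding complete_in_def by blast
qed

section \<open>Effect of a single attack on completeness\<close>

lemma complete_in_insert_outside:
  assumes "complete_in A S R" "a \<notin> S" "b \<notin> S"
  shows "complete_in A S (insert (a, b) R)"
proof -
  have im: "insert (a, b) R `` S = R `` S"
    using assms(2) by auto
  show ?thesis
    using assms unfolding complete_in_def im by blast
qed

text \<open>The attacked set stays the same, so the only new demand is an answer to
  \<open>a\<close>. Such an attack can destroy completeness but never create it.\<close>

lemma complete_in_insert_into_iff: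
  assumes "a \<notin> S" "b \<in> S"
  shows "complete_in A S (insert (a, b) R) \<longleftrightarrow> complete_in A S R \<and> a \<in> R `` S"
proof -
  have im: "insert (a, b) R `` S = R `` S"
    using assms(1) by auto
  show ?thesis
    using assms unfolding complete_in_def im by blast
qed

text \<open>Without \<open>(a, b)\<close> the attacked set can lose only \<open>b\<close>, so no
  conflict arises. An attack on \<open>S\<close> becomes unanswered only if it comes from
  \<open>b\<close>, and an argument outside \<open>S\<close> becomes defended only if it is
  \<open>b\<close> itself.\<close>

lemma not_complete_in_without_iff:
  assumes "b \<in> A" "b \<notin> S" "(a, b) \<notin> R" and com: "complete_in A S (insert (a, b) R)"
  shows "\<not> complete_in A S R \<longleftrightarrow>
    a \<in> S \<and> b \<notin> R `` S \<and> (\<exists>s\<in>S. (b, s) \<in> R) \<or> sole_attacker S (insert (a, b) R) a b"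
proof -
  let ?R = "insert (a, b) R"
  have im: "R `` S \<subseteq> ?R `` S" "?R `` S \<subseteq> insert b (R `` S)"
    by auto
  \<comment> \<open>The right-hand side says that \<open>S\<close> defends \<open>b\<close> in
    \<open>R\<close>. Since \<open>b\<close> has an unanswered attacker once \<open>(a, b)\<close>
    is present, that attacker must then be \<open>a\<close>.\<close>
  have sole: "sole_attacker S ?R a b \<longleftrightarrow> (\<forall>u. (u, b) \<in> R \<longrightarrow> u \<in> R `` S)"
  proof -
    have minus: "?R - {(a, b)} = R"
      using assms(3) by auto
    obtain y where "(y, b) \<in> ?R" "y \<notin> ?R `` S"
      using com assms(1,2) unfolding complete_in_def by blast
    then show ?thesis
      using assms(3) im(1) unfolding sole_attacker_def minus by blast
  qed
  show ?thesis
  proof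
    assume "\<not> complete_in A S R"
    then consider (conflict) "S \<inter> R `` S \<noteq> {}"
      | (undefended) x y where "x \<in> S" "(y, x) \<in> R" "y \<notin> R `` S"
      | (defended) x where "x \<in> A - S" "\<And>y. (y, x) \<in> R \<Longrightarrow> y \<in> R `` S"
      unfolding complete_in_def by blast
    then show "a \<in> S \<and> b \<notin> R `` S \<and> (\<exists>s\<in>S. (b, s) \<in> R) \<or> sole_attacker S ?R a b"
    proof cases
      case conflict
      then show ?thesis
        using com im(1) unfolding complete_in_def by blast
    next
      case undefended
      then have "y \<in> ?R `` S"
        using com unfolding complete_in_def by blast
      then show ?thesis
        using undefended by auto
    next
      case defended
      then obtain y where "(y, x) \<in> ?R" "y \<notin> ?R `` S"
        using com unfolding complete_in_def by blast
      then have "x = b"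
        using defended(2) im(1) by blast
      then show ?thesis
        using defended(2) sole by blast
    qed
  next
    assume "a \<in> S \<and> b \<notin> R `` S \<and> (\<exists>s\<in>S. (b, s) \<in> R) \<or> sole_attacker S ?R a b"
    then show "\<not> complete_in A S R"
      using assms(1,2) sole unfolding complete_in_def by blast
  qed
qed

text \<open>The attacked set gains at most \<open>b\<close>, which is outside \<open>S\<close>, so
  conflict-freeness and defence persist. Completeness fails only if some \<open>v\<close> outside
  \<open>S\<close> loses its last unanswered attacker, which must have been
  \<open>b\<close>.\<close>

lemma not_complete_in_insert_from_iff:
  assumes "a \<in> S" "b \<notin> S" and com: "complete_in A S R"
  shows "\<not> complete_in A S (insert (a, b) R) \<longleftrightarrow>
    (\<exists>v\<in>A - (S \<union> {b}). sole_attacker S R b v)"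
proof -
  let ?R = "insert (a, b) R"
  have im: "?R `` S = insert b (R `` S)"
    using assms(1) by auto
  have a: "a \<notin> insert b (R `` S)"
    using assms unfolding complete_in_def by blast
  have minus: "(R - {(b, v)}) `` S = R `` S" for v
    using assms(2) by auto
  show ?thesis
  proof
    assume "\<not> complete_in A S ?R"
    moreover have "S \<inter> ?R `` S = {}" "\<forall>x\<in>S. \<forall>y. (y, x) \<in> ?R \<longrightarrow> y \<in> ?R `` S"
      using assms unfolding complete_in_def im by blast+
    ultimately obtain v where v: "v \<in> A - S" "\<And>y. (y, v) \<in> ?R \<Longrightarrow> y \<in> insert b (R `` S)"
      unfolding complete_in_def im by blast
    \<comment> \<open>In the new relation \<open>b\<close> is attacked by \<open>a\<close>, which
      \<open>S\<close> does not attack.\<close>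
    then have "v \<noteq> b"
      using a by blast
    moreover obtain y where "(y, v) \<in> R" "y \<notin> R `` S"
      using com v(1) unfolding complete_in_def by blast
    ultimately show "\<exists>v\<in>A - (S \<union> {b}). sole_attacker S R b v"
      using v unfolding sole_attacker_def minus by blast
  next
    assume "\<exists>v\<in>A - (S \<union> {b}). sole_attacker S R b v"
    then obtain v where v: "v \<in> A - S" "v \<noteq> b" "\<And>y. (y, v) \<in> R \<Longrightarrow> y \<in> insert b (R `` S)"
      unfolding sole_attacker_def minus by blast
    then have "y \<in> ?R `` S" if "(y, v) \<in> ?R" for y
      using that unfolding im by blast
    then show "\<not> complete_in A S ?R"
      using v(1) unfolding complete_in_def by blast
  qed
qed

section \<open>Relevance criteria by the position of the attack\<close>

text \<open>The sole-attacker alternative of \<open>not_complete_in_without_iff\<close> turns into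
  \<open>OutRel\<close>. The other one, where \<open>(a, b)\<close> is needed to defend
  \<open>S\<close> against \<open>b\<close>, requires \<open>a \<in> S\<close> and is left in terms
  of \<open>R\<close>.\<close>

lemma RE_plus_outside_iff:
  assumes I: "is_atiaf I" and S: "S \<subseteq> args I" and e: "(a, b) \<in> uatts I" and b: "b \<notin> S"
  shows "(a, b) \<in> RE_plus I S co_true \<longleftrightarrow>
    (b, b) \<notin> atts I \<and> OutRel I S (a, b) \<or>
    a \<in> S \<and> (\<exists>R. atts I \<subseteq> R \<and> R \<subseteq> atts I \<union> uatts I - {(a, b)} \<and>
      complete_in (args I) S (insert (a, b) R) \<and> b \<notin> R `` S \<and> (\<exists>s\<in>S. (b, s) \<in> R))"
    (is "_ \<longleftrightarrow> ?out \<or> ?pos")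
proof -
  have bA: "b \<in> args I"
    using e atiaf_atts(2)[OF I] by blast
  have e_atts: "(a, b) \<notin> atts I"
    using e atiaf_atts(3)[OF I] by blast
  let ?bounds = "\<lambda>R. atts I \<subseteq> R \<and> R \<subseteq> atts I \<union> uatts I - {(a, b)}"
  have "(a, b) \<in> RE_plus I S co_true \<longleftrightarrow>
    (\<exists>R. ?bounds R \<and> complete_in (args I) S (insert (a, b) R) \<and>
      (a \<in> S \<and> b \<notin> R `` S \<and> (\<exists>s\<in>S. (b, s) \<in> R) \<or> sole_attacker S (insert (a, b) R) a b))"
    unfolding RE_plus_iff[OF I S e] conj_assoc
    by (intro ex_cong1 conj_cong refl not_complete_in_without_iff[OF bA b]) auto
  then have "(a, b) \<in> RE_plus I S co_true \<longleftrightarrow>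
    (\<exists>R. ?bounds R \<and> complete_in (args I) S (insert (a, b) R) \<and>
      sole_attacker S (insert (a, b) R) a b) \<or> ?pos"
    by blast
  moreover have "(\<exists>R. ?bounds R \<and> complete_in (args I) S (insert (a, b) R) \<and>
      sole_attacker S (insert (a, b) R) a b) \<longleftrightarrow> ?out" (is "?sole \<longleftrightarrow> _")
  proof
    assume ?sole
    then obtain R where R: "?bounds R" "complete_in (args I) S (insert (a, b) R)"
        "sole_attacker S (insert (a, b) R) a b"
      by blast
    have bb: "(b, b) \<notin> atts I"
      using sole_attacker_not_self[OF R(2,3)] R(1) e_atts by blast
    have "atts I \<subseteq> insert (a, b) R" "insert (a, b) R \<subseteq> atts I \<union> uatts I"
      using R(1) e by auto
    then show ?out
      using bb OutRel_iff[OF I S _ b bb, of a] e R(2,3) by blast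
  next
    assume out: ?out
    then obtain R where R: "atts I \<subseteq> R" "R \<subseteq> atts I \<union> uatts I" "complete_in (args I) S R"
        "sole_attacker S R a b"
      using OutRel_iff[OF I S _ b, of a] e by blast
    have "insert (a, b) (R - {(a, b)}) = R"
      using R(4) unfolding sole_attacker_def by blast
    then show ?sole
      using R e_atts by (intro exI[of _ "R - {(a, b)}"]) auto
  qed
  ultimately show ?thesis
    by blast
qed

text \<open>For the converse direction, a completion given by \<open>PosVer_co\<close> may lack
  attacks from \<open>b\<close> on \<open>S\<close> and may contain further attacks from
  \<open>S\<close> on \<open>b\<close>. Rewiring it around \<open>b\<close> repairs both.\<close>

lemma ex_complete_in_attacking_iff:
  assumes I: "is_atiaf I" and S: "S \<subseteq> args I" and e: "(a, b) \<in> uatts I"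
    and a: "a \<in> S" and b: "b \<notin> S"
  shows "(\<exists>R. atts I \<subseteq> R \<and> R \<subseteq> atts I \<union> uatts I - {(a, b)} \<and>
      complete_in (args I) S (insert (a, b) R) \<and> b \<notin> R `` S \<and> (\<exists>s\<in>S. (b, s) \<in> R)) \<longleftrightarrow>
    \<not> S \<subseteq> non_out_set I {b} \<and> b \<notin> out_set I S \<and> PosVer_co (add_atts I {(a, b)}) S"
    (is "?L \<longleftrightarrow> ?R")
proof -
  have bA: "b \<in> args I"
    using e atiaf_atts(2)[OF I] by blast
  have non_out: "\<not> S \<subseteq> non_out_set I {b} \<longleftrightarrow> (\<exists>s\<in>S. (b, s) \<in> atts I \<union> uatts I)"
    using S by (auto simp: non_out_set_def)
  have out: "b \<notin> out_set I S \<longleftrightarrow> (\<forall>s\<in>S. (s, b) \<notin> atts I)"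
    using bA by (auto simp: out_set_def)
  have Un: "insert (a, b) (atts I \<union> (uatts I - {(a, b)})) = atts I \<union> uatts I"
    using e by auto
  have pos: "PosVer_co (add_atts I {(a, b)}) S \<longleftrightarrow>
    (\<exists>R. insert (a, b) (atts I) \<subseteq> R \<and> R \<subseteq> atts I \<union> uatts I \<and> complete_in (args I) S R)"
    using PosVer_co_iff[OF is_atiaf_add_atts[OF I, of "{(a, b)}"], of S] e S Un
    by (simp add: add_atts_def)
  show ?thesis
  proof
    assume ?L
    then obtain R where R: "atts I \<subseteq> R" "R \<subseteq> atts I \<union> uatts I - {(a, b)}"
        "complete_in (args I) S (insert (a, b) R)" "b \<notin> R `` S" "\<exists>s\<in>S. (b, s) \<in> R"
      by blast
    have "insert (a, b) (atts I) \<subseteq> insert (a, b) R" "insert (a, b) R \<subseteq> atts I \<union> uatts I"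
      using R(1,2) e by auto
    then show ?R
      unfolding non_out out pos using R by blast
  next
    assume ?R
    then obtain s R where s: "s \<in> S" "(b, s) \<in> atts I \<union> uatts I"
      and out: "\<forall>s\<in>S. (s, b) \<notin> atts I"
      and R: "insert (a, b) (atts I) \<subseteq> R" "R \<subseteq> atts I \<union> uatts I" "complete_in (args I) S R"
      unfolding non_out out pos by blast
    \<comment> \<open>Attacks from \<open>S\<close> on \<open>b\<close> may be dropped because none
      is certain. The attack \<open>(b, s)\<close> is answered by \<open>(a, b)\<close>, which also
      keeps \<open>b\<close> attacked and undefended.\<close>
    define R' where "R' = insert (b, s) (R - S \<times> {b})"
    have im: "insert (a, b) R' `` S = R `` S"
      using R(1) a b unfolding R'_def by auto
    have aR: "a \<notin> R `` S" "b \<in> R `` S"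
      using R(1,3) a unfolding complete_in_def by auto
    have "atts I \<subseteq> R'" "R' \<subseteq> atts I \<union> uatts I - {(a, b)}" "b \<notin> R' `` S" "(b, s) \<in> R'"
      using R(1,2) s out a b unfolding R'_def by auto
    moreover have "complete_in (args I) S (insert (a, b) R')"
      unfolding complete_in_def im
    proof (intro conjI ballI allI impI)
      show "S \<inter> R `` S = {}"
        using R(3) unfolding complete_in_def by blast
    next
      fix x y assume "x \<in> S" "(y, x) \<in> insert (a, b) R'"
      then show "y \<in> R `` S"
        using R(3) aR(2) b unfolding complete_in_def R'_def by blast
    next
      fix x assume "x \<in> args I - S"
      then show "\<exists>y. (y, x) \<in> insert (a, b) R' \<and> y \<notin> R `` S"
        using R(3) aR(1) unfolding complete_in_def R'_def by (cases "x = b") blast+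
    qed
    ultimately show ?L
      using s(1) by blast
  qed
qed

text \<open>By \<open>complete_in_insert_into_iff\<close>, what is needed is a completion in which
  \<open>S\<close> is complete and does not attack \<open>a\<close>. Deleting the uncertain attacks
  from \<open>S\<close> on \<open>a\<close> enforces the latter when none is certain.\<close>

lemma RE_minus_into_iff:
  assumes I: "is_atiaf I" and S: "S \<subseteq> args I" and e: "(a, b) \<in> uatts I"
    and a: "a \<notin> S" and b: "b \<in> S"
  shows "(a, b) \<in> RE_minus I S co_true \<longleftrightarrow>
    a \<notin> out_set I S \<and> PosVer_co (del_atts I {(s, v) \<in> uatts I. s \<in> S \<and> v = a}) S"
proof -
  let ?D = "{(s, v) \<in> uatts I. s \<in> S \<and> v = a}"
  have aA: "a \<in> args I"
    using e atiaf_atts(2)[OF I] by blast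
  have out: "a \<notin> out_set I S \<longleftrightarrow> (\<forall>s\<in>S. (s, a) \<notin> atts I)"
    using aA by (auto simp: out_set_def)
  have RE: "(a, b) \<in> RE_minus I S co_true \<longleftrightarrow>
    (\<exists>R. atts I \<subseteq> R \<and> R \<subseteq> atts I \<union> uatts I - {(a, b)} \<and>
      complete_in (args I) S R \<and> a \<notin> R `` S)"
    unfolding RE_minus_iff[OF I S e] complete_in_insert_into_iff[OF a b] by blast
  have pos: "PosVer_co (del_atts I ?D) S \<longleftrightarrow>
    (\<exists>R. atts I \<subseteq> R \<and> R \<subseteq> atts I \<union> (uatts I - ?D) \<and> complete_in (args I) S R)"
    using PosVer_co_iff[OF is_atiaf_del_atts[OF I, of ?D], of S] S by (simp add: del_atts_def)
  show ?thesis
  proof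
    assume "(a, b) \<in> RE_minus I S co_true"
    then obtain R where R: "atts I \<subseteq> R" "R \<subseteq> atts I \<union> uatts I - {(a, b)}"
        "complete_in (args I) S R" "a \<notin> R `` S"
      unfolding RE by blast
    then have "R \<subseteq> atts I \<union> (uatts I - ?D)"
      by auto
    then show "a \<notin> out_set I S \<and> PosVer_co (del_atts I ?D) S"
      unfolding out pos using R by blast
  next
    assume "a \<notin> out_set I S \<and> PosVer_co (del_atts I ?D) S"
    then obtain R where R: "\<forall>s\<in>S. (s, a) \<notin> atts I" "atts I \<subseteq> R"
        "R \<subseteq> atts I \<union> (uatts I - ?D)" "complete_in (args I) S R"
      unfolding out pos by blast
    then have "a \<notin> R `` S"
      by blast
    \<comment> \<open>It would be an unanswered attack on \<open>b \<in> S\<close>.\<close>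
    moreover from this have "(a, b) \<notin> R"
      using R(4) b unfolding complete_in_def by blast
    ultimately have "R \<subseteq> atts I \<union> uatts I - {(a, b)}" "a \<notin> R `` S"
      using R(3) by blast+
    then show "(a, b) \<in> RE_minus I S co_true"
      unfolding RE using R(2,4) by blast
  qed
qed

text \<open>The completions provided by \<open>OutRel_iff\<close> range over relations with or
  without \<open>(a, b)\<close>. If \<open>b\<close> is the sole unanswered attacker of
  \<open>v\<close>, then \<open>S\<close> does not attack \<open>b\<close>, so \<open>(a, b)\<close>
  is absent.\<close>

lemma RE_minus_from_iff:
  assumes I: "is_atiaf I" and S: "S \<subseteq> args I" and e: "(a, b) \<in> uatts I"
    and a: "a \<in> S" and b: "b \<notin> S"
  shows "(a, b) \<in> RE_minus I S co_true \<longleftrightarrow>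
    (\<exists>v\<in>args I - (S \<union> {b}). (b, v) \<in> atts I \<union> uatts I \<and> (v, v) \<notin> atts I \<and> OutRel I S (b, v))"
proof -
  have RE: "(a, b) \<in> RE_minus I S co_true \<longleftrightarrow>
    (\<exists>v\<in>args I - (S \<union> {b}). \<exists>R. atts I \<subseteq> R \<and> R \<subseteq> atts I \<union> uatts I - {(a, b)} \<and>
      complete_in (args I) S R \<and> sole_attacker S R b v)"
  proof -
    have "(a, b) \<in> RE_minus I S co_true \<longleftrightarrow>
      (\<exists>R. atts I \<subseteq> R \<and> R \<subseteq> atts I \<union> uatts I - {(a, b)} \<and> complete_in (args I) S R \<and>
        (\<exists>v\<in>args I - (S \<union> {b}). sole_attacker S R b v))"
      unfolding RE_minus_iff[OF I S e]
      by (intro ex_cong1 conj_cong refl not_complete_in_insert_from_iff[OF a b])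
    then show ?thesis
      by blast
  qed
  have "(\<exists>R. atts I \<subseteq> R \<and> R \<subseteq> atts I \<union> uatts I - {(a, b)} \<and>
      complete_in (args I) S R \<and> sole_attacker S R b v) \<longleftrightarrow>
    (b, v) \<in> atts I \<union> uatts I \<and> (v, v) \<notin> atts I \<and> OutRel I S (b, v)" (is "?L \<longleftrightarrow> ?R")
    if v: "v \<in> args I - (S \<union> {b})" for v
  proof
    assume ?L
    then obtain R where R: "atts I \<subseteq> R" "R \<subseteq> atts I \<union> uatts I - {(a, b)}"
        "complete_in (args I) S R" "sole_attacker S R b v"
      by blast
    have bv: "(b, v) \<in> atts I \<union> uatts I"
      using R(2,4) unfolding sole_attacker_def by blast
    have vv: "(v, v) \<notin> atts I"
      using sole_attacker_not_self[OF R(3,4)] v R(1) by blast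
    show ?R
      using OutRel_iff[OF I S bv _ vv] bv vv v R by blast
  next
    assume ?R
    then obtain R where R: "atts I \<subseteq> R" "R \<subseteq> atts I \<union> uatts I" "complete_in (args I) S R"
        "sole_attacker S R b v"
      using OutRel_iff[OF I S, of b v] v by blast
    then have "(a, b) \<notin> R"
      using a unfolding sole_attacker_def by blast
    then show ?L
      using R by blast
  qed
  then show ?thesis
    unfolding RE by (intro bex_cong refl)
qed

theorem theorem1:
  fixes I :: "'a iaf" and S :: "'a set"
  assumes "is_atiaf I"
    and "S \<subseteq> args I"
    and "\<not> stable_co I S"
  shows "\<forall>a b. (a, b) \<in> uatts I \<and> (a \<notin> S \<or> b \<notin> S) \<longrightarrow>
    (a \<notin> S \<and> b \<notin> S \<longrightarrow>
      ((a, b) \<in> RE_plus I S co_true \<longleftrightarrow> (b, b) \<notin> atts I \<and> OutRel I S (a, b)) \<and>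
      (a, b) \<notin> RE_minus I S co_true) \<and>
    (a \<notin> S \<and> b \<in> S \<longrightarrow>
      (a, b) \<notin> RE_plus I S co_true \<and>
      ((a, b) \<in> RE_minus I S co_true \<longleftrightarrow>
        a \<notin> out_set I S \<and>
        PosVer_co (del_atts I {(s, v) \<in> uatts I. s \<in> S \<and> v = a}) S)) \<and>
    (a \<in> S \<and> b \<notin> S \<longrightarrow>
      ((a, b) \<in> RE_plus I S co_true \<longleftrightarrow>
        ((b, b) \<notin> atts I \<and> OutRel I S (a, b)) \<or>
        (\<not> S \<subseteq> non_out_set I {b} \<and> b \<notin> out_set I S \<and> PosVer_co (add_atts I {(a, b)}) S)) \<and>
      ((a, b) \<in> RE_minus I S co_true \<longleftrightarrow>
        (\<exists>v \<in> args I - (S \<union> {b}).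
          (b, v) \<in> atts I \<union> uatts I \<and> (v, v) \<notin> atts I \<and> OutRel I S (b, v))))"
proof (intro allI impI conjI; (elim conjE)?)
  note I = assms(1) and S = assms(2)
  fix a b
  assume e: "(a, b) \<in> uatts I"
  {
    assume ab: "a \<notin> S" "b \<notin> S"
    show "(a, b) \<in> RE_plus I S co_true \<longleftrightarrow> (b, b) \<notin> atts I \<and> OutRel I S (a, b)"
      using RE_plus_outside_iff[OF I S e ab(2)] ab(1) by blast
    show "(a, b) \<notin> RE_minus I S co_true"
      unfolding RE_minus_iff[OF I S e] using complete_in_insert_outside[OF _ ab] by blast
  next
    assume ab: "a \<notin> S" "b \<in> S"
    show "(a, b) \<notin> RE_plus I S co_true"
      unfolding RE_plus_iff[OF I S e] complete_in_insert_into_iff[OF ab] by blast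
    show "(a, b) \<in> RE_minus I S co_true \<longleftrightarrow>
        a \<notin> out_set I S \<and> PosVer_co (del_atts I {(s, v) \<in> uatts I. s \<in> S \<and> v = a}) S"
      by (rule RE_minus_into_iff[OF I S e ab])
  next
    assume ab: "a \<in> S" "b \<notin> S"
    show "(a, b) \<in> RE_plus I S co_true \<longleftrightarrow>
        (b, b) \<notin> atts I \<and> OutRel I S (a, b) \<or>
        \<not> S \<subseteq> non_out_set I {b} \<and> b \<notin> out_set I S \<and> PosVer_co (add_atts I {(a, b)}) S"
      using RE_plus_outside_iff[OF I S e ab(2)] ex_complete_in_attacking_iff[OF I S e ab] ab(1)
      by blast
    show "(a, b) \<in> RE_minus I S co_true \<longleftrightarrow>
        (\<exists>v\<in>args I - (S \<union> {b}).
          (b, v) \<in> atts I \<union> uatts I \<and> (v, v) \<notin> atts I \<and> OutRel I S (b, v))"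
      by (rule RE_minus_from_iff[OF I S e ab])
  }
qed

end
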